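(* Let $n>1$, and let $E_n(k^m)=v_{n,2n-m}/v_{n,2n}$ ($m=1,\dots,2n$) be the Vieta equations of the degree-$2n$ pole-skipping polynomial $P_n(k)=\det\mathcal M^{(n)}=\sum_{m=0}^{2n}V_{n,m}k^m$ of the three-dimensional rotating black hole (defined in the context), where $v_{n,m}=(-1)^{n-m}V_{n,m}$. Treat all lower-order coefficients $f_{1i},f_{2i},f_{3i}$ with $i<n$ (together with $T$ and the scalar mass $m$) as fixed parameters. Then, as equations in the unknowns $f_{1n},f_{2n},f_{3n}$: (i) the equation $E_n(k^{2n})=v_{n,0}/v_{n,2n}$ is linear in $(f_{1n},f_{2n})$; (ii) the equation $E_n(k^{2n-1})=v_{n,1}/v_{n,2n}$ is linear in $(f_{1n},f_{2n},f_{3n})$; (iii) the equation $E_n(k^{2n-2})=v_{n,2}/v_{n,2n}$ is linear in $(f_{1n},f_{2n})$. Here "linear in" the listed unknowns means that the right-hand side is a polynomial of degree at most one in the listed unknowns, with coefficients depending only on the fixed parameters (so it involves no other unknown coefficient).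
   Context: Metric: $ds^2=-\frac{f_1(z)}{z^2}dt^2+\frac{dz^2}{z^2f_2(z)}+\frac1{z^2}(d\varphi-f_3(z)dt)^2$, with horizon at $z=1$, and $f_1,f_2,f_3$ analytic near $z=1$: $f_1=\sum_{i\ge1}f_{1i}(z-1)^i$, $f_2=\sum_{i\ge1}f_{2i}(z-1)^i$, $f_3=\Omega_H+\sum_{i\ge1}f_{3i}(z-1)^i$, where $f_{11}f_{21}=(4\pi T)^2$ with $T>0$ the Hawking temperature. A free scalar of mass $m$, $\Phi=e^{-i\omega t+ik\varphi}\psi(z)$, satisfies $A\psi''+B\psi'+C\psi=0$, where $A=f_1f_2=\sum_{j\ge2}A_j(z-1)^j$, $B=\frac12(f_1f_2)'-\frac{f_1f_2}{z}=\sum_{j\ge1}B_j(z-1)^j$, $C=(\omega-kf_3)^2-f_1\frac{k^2z^2+m^2}{z^2}=\sum_{j\ge0}C_j(z-1)^j$. Put $\mathfrak w=\omega-k\Omega_H$ and $\rho=-i\mathfrak w/(4\pi T)$ (ingoing exponent). Inserting $\psi=(z-1)^\rho\sum_{j}\phi_j(z-1)^j$, the coefficient of $\phi_{S-1}$ at order $(z-1)^{\rho+K}$ is $$M_{KS}=A_{K-S+3}(\rho+S-1)(\rho+S-2)+B_{K-S+2}(\rho+S-1)+C_{K-S+1},$$ with the convention that coefficients below the lowest order ($A_j$ for $j<2$, $B_j$ for $j<1$, $C_j$ for $j<0$) are zero. $\mathcal M^{(n)}=(M_{KS})_{1\le K,S\le n}$ is evaluated at the pole-skipping frequency $\mathfrak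 w=\mathfrak w_n=-2\pi i Tn$ (so $\rho=-n/2$, and $\omega-kf_3=\mathfrak w_n-k(f_3-\Omega_H)$). With $\mathfrak w_n$ held fixed, $\det\mathcal M^{(n)}$ is a polynomial in $k$ of degree exactly $2n$, denoted $P_n(k)$, with roots $k_{n,1},\dots,k_{n,2n}$ (with multiplicity). $E_n(k^m)$ denotes the elementary symmetric polynomial of degree $m$ in these roots. *)

theory Defs
  imports "HOL-Analysis.Derivative" "Jordan_Normal_Form.Determinant"
begin

text \<open>The metric functions are real functions of the real coordinate \<open>z\<close>, while the
  coefficient function \<open>C\<close> of the wave equation is complex valued because the frequency and
  \<open>k\<close> are complex. Both kinds of function are expanded in powers of \<open>z - 1\<close>.\<close>

definition expands_at_horizon :: "(real \<Rightarrow> 'a::real_normed_vector) \<Rightarrow> (nat \<Rightarrow> 'a) \<Rightarrow> bool" where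
  "expands_at_horizon g c \<longleftrightarrow>
     (\<forall>\<^sub>F z in nhds 1. (\<lambda>j. (z - 1) ^ j *\<^sub>R c j) sums g z)"

definition analytic_at_horizon :: "(real \<Rightarrow> 'a::real_normed_vector) \<Rightarrow> bool" where
  "analytic_at_horizon g \<longleftrightarrow> (\<exists>c. expands_at_horizon g c)"

definition hcoeff :: "(real \<Rightarrow> 'a::real_normed_vector) \<Rightarrow> nat \<Rightarrow> 'a" where
  "hcoeff g = (THE c. expands_at_horizon g c)"

definition hcoeff_from :: "int \<Rightarrow> (real \<Rightarrow> 'a::real_normed_vector) \<Rightarrow> int \<Rightarrow> 'a" where
  "hcoeff_from l g j = (if j < l then 0 else hcoeff g (nat j))"

text \<open>The metric is
  \<open>ds\<^sup>2 = - f1(z)/z\<^sup>2 dt\<^sup>2 + dz\<^sup>2/(z\<^sup>2 f2(z)) + (d\<phi> - f3(z) dt)\<^sup>2/z\<^sup>2\<close>, with horizon at \<open>z = 1\<close>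
  and Hawking temperature \<open>T\<close>.\<close>

definition rotating_black_hole ::
  "(real \<Rightarrow> real) \<Rightarrow> (real \<Rightarrow> real) \<Rightarrow> (real \<Rightarrow> real) \<Rightarrow> real \<Rightarrow> bool" where
  "rotating_black_hole f1 f2 f3 T \<longleftrightarrow>
     analytic_at_horizon f1 \<and> analytic_at_horizon f2 \<and> analytic_at_horizon f3 \<and>
     f1 1 = 0 \<and> f2 1 = 0 \<and>
     T > 0 \<and> hcoeff f1 1 * hcoeff f2 1 = (4 * pi * T)\<^sup>2"

text \<open>All black holes of temperature \<open>T\<close> whose coefficients of order \<open>1, \<dots>, n - 1\<close> are
  prescribed by \<open>a1, a2, a3\<close>; the coefficients of order \<open>n\<close> and higher, and the horizon angular
  velocity \<open>f3 1\<close>, remain free.\<close>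

definition black_holes_with ::
  "nat \<Rightarrow> real \<Rightarrow> (nat \<Rightarrow> real) \<Rightarrow> (nat \<Rightarrow> real) \<Rightarrow> (nat \<Rightarrow> real)
    \<Rightarrow> ((real \<Rightarrow> real) \<times> (real \<Rightarrow> real) \<times> (real \<Rightarrow> real)) set" where
  "black_holes_with n T a1 a2 a3 =
     {(f1, f2, f3). rotating_black_hole f1 f2 f3 T \<and>
        (\<forall>i\<in>{1..<n}. hcoeff f1 i = a1 i \<and> hcoeff f2 i = a2 i \<and> hcoeff f3 i = a3 i)}"

text \<open>The radial equation is \<open>A \<psi>'' + B \<psi>' + C \<psi> = 0\<close>.\<close>

definition A_fun :: "(real \<Rightarrow> real) \<Rightarrow> (real \<Rightarrow> real) \<Rightarrow> real \<Rightarrow> real" where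
  "A_fun f1 f2 z = f1 z * f2 z"

definition B_fun :: "(real \<Rightarrow> real) \<Rightarrow> (real \<Rightarrow> real) \<Rightarrow> real \<Rightarrow> real" where
  "B_fun f1 f2 z = deriv (\<lambda>x. f1 x * f2 x) z / 2 - f1 z * f2 z / z"

text \<open>Only \<open>m\<^sup>2\<close> enters; a complex \<open>m\<close> also covers negative \<open>m\<^sup>2\<close>.\<close>

definition C_fun ::
  "(real \<Rightarrow> real) \<Rightarrow> (real \<Rightarrow> real) \<Rightarrow> complex \<Rightarrow> complex \<Rightarrow> complex \<Rightarrow> real \<Rightarrow> complex" where
  "C_fun f1 f3 m \<omega> k z =
     (\<omega> - k * of_real (f3 z))\<^sup>2
       - of_real (f1 z) * ((k\<^sup>2 * of_real (z\<^sup>2) + m\<^sup>2) / of_real (z\<^sup>2))"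

text \<open>Coefficient of \<open>\<phi>\<close> with index \<open>S - 1\<close> at order \<open>(z - 1)\<^sup>\<rho>\<^sup>+\<^sup>K\<close> after inserting
  \<open>\<psi> = (z - 1)\<^sup>\<rho> \<Sum>\<^sub>j \<phi>\<^sub>j (z - 1)\<^sup>j\<close>, as a function of \<open>w = \<omega> - k \<Omega>\<close> and \<open>k\<close>,
  where \<open>\<Omega> = f3 1\<close> and \<open>\<rho>\<close> is the ingoing exponent.\<close>

definition M_entry ::
  "(real \<Rightarrow> real) \<Rightarrow> (real \<Rightarrow> real) \<Rightarrow> (real \<Rightarrow> real) \<Rightarrow> real \<Rightarrow> complex
    \<Rightarrow> complex \<Rightarrow> complex \<Rightarrow> nat \<Rightarrow> nat \<Rightarrow> complex" where
  "M_entry f1 f2 f3 T m w k K S =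
     (let \<rho> = - \<i> * w / of_real (4 * pi * T);
          \<omega> = w + k * of_real (f3 1);
          A = (\<lambda>j. of_real (hcoeff_from 2 (A_fun f1 f2) j));
          B = (\<lambda>j. of_real (hcoeff_from 1 (B_fun f1 f2) j));
          C = hcoeff_from 0 (C_fun f1 f3 m \<omega> k)
      in A (int K - int S + 3) * ((\<rho> + of_nat S - 1) * (\<rho> + of_nat S - 2))
         + B (int K - int S + 2) * (\<rho> + of_nat S - 1)
         + C (int K - int S + 1))"

definition w_skip :: "real \<Rightarrow> nat \<Rightarrow> complex" where
  "w_skip T n = - 2 * of_real pi * \<i> * of_real T * of_nat n"

text \<open>Matrix indices start at \<open>0\<close>, hence the shift by one.\<close>

definition M_mat ::
  "(real \<Rightarrow> real) \<Rightarrow> (real \<Rightarrow> real) \<Rightarrow> (real \<Rightarrow> real) \<Rightarrow> real \<Rightarrow> complex \<Rightarrow> nat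
    \<Rightarrow> complex \<Rightarrow> complex mat" where
  "M_mat f1 f2 f3 T m n k =
     mat n n (\<lambda>(i, j). M_entry f1 f2 f3 T m (w_skip T n) k (Suc i) (Suc j))"

definition skip_poly ::
  "(real \<Rightarrow> real) \<Rightarrow> (real \<Rightarrow> real) \<Rightarrow> (real \<Rightarrow> real) \<Rightarrow> real \<Rightarrow> complex \<Rightarrow> nat
    \<Rightarrow> complex poly" where
  "skip_poly f1 f2 f3 T m n = (THE P. \<forall>k. poly P k = det (M_mat f1 f2 f3 T m n k))"

definition v_coeff ::
  "(real \<Rightarrow> real) \<Rightarrow> (real \<Rightarrow> real) \<Rightarrow> (real \<Rightarrow> real) \<Rightarrow> real \<Rightarrow> complex \<Rightarrow> nat \<Rightarrow> nat
    \<Rightarrow> complex" where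
  "v_coeff f1 f2 f3 T m n j =
     (-1) powi (int n - int j) * coeff (skip_poly f1 f2 f3 T m n) j"

text \<open>\<open>\<kappa> 1, \<dots>, \<kappa> N\<close> enumerate the roots of \<open>P\<close> with multiplicity.\<close>

definition enumerates_roots :: "complex poly \<Rightarrow> nat \<Rightarrow> (nat \<Rightarrow> complex) \<Rightarrow> bool" where
  "enumerates_roots P N \<kappa> \<longleftrightarrow> image_mset \<kappa> (mset_set {1..N}) = proots P"

definition elem_sym :: "nat \<Rightarrow> (nat \<Rightarrow> complex) \<Rightarrow> nat \<Rightarrow> complex" where
  "elem_sym N \<kappa> j = (\<Sum>I | I \<subseteq> {1..N} \<and> card I = j. \<Prod>i\<in>I. \<kappa> i)"

end

theory Submission
  imports Defs "HOL-Analysis.FPS_Convergence"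
    "HOL-Computational_Algebra.Fundamental_Theorem_Algebra"
begin

text \<open>The matrix is lower Hessenberg: above the superdiagonal it vanishes, and at the
  pole-skipping frequency the superdiagonal does not depend on \<open>k\<close>. All other entries are quadratic
  in \<open>k\<close>, so the top coefficient comes from the diagonal alone and equals \<open>(- f11)\<^sup>n\<close>.
  Coefficients of order \<open>n\<close> enter only through the three entries in the lower left corner. The
  determinant is affine in these, because the two entries next to the corner occur together in a
  product only for \<open>n = 2\<close>, where one of them turns out not to contain the unknowns. The corner entry
  itself could contain coefficients of order \<open>n + 1\<close>, but they carry the factor
  \<open>\<rho> (\<rho> + n / 2)\<close>, which vanishes at \<open>\<rho> = - n / 2\<close>. Finally \<open>f3n\<close> occurs only in the \<open>k\<close>-linear
  part of the corner entry, whose cofactor is independent of \<open>k\<close>.\<close>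

section \<open>Hessenberg determinants\<close>

text \<open>\<open>e\<close> is an infinite array, so the leading minors of all sizes come from one
  function and can be linked by a recursion.\<close>

definition leading_det :: "(nat \<Rightarrow> nat \<Rightarrow> 'a::comm_ring_1) \<Rightarrow> nat \<Rightarrow> 'a" where
  "leading_det e r = det (mat r r (\<lambda>(i, j). e i j))"

lemma leading_det_0 [simp]: "leading_det e 0 = 1"
  by (simp add: leading_det_def det_def)

text \<open>Only the last two entries of the last column can be nonzero. Deleting the last row
  leaves a leading minor; deleting the row before it leaves a matrix of the same form with last row
  \<open>v\<close>, hence the arbitrary last row.\<close>

lemma det_hessenberg_last_row:
  fixes e :: "nat \<Rightarrow> nat \<Rightarrow> 'a::comm_ring_1"
  assumes "\<And>i j. Suc i < j \<Longrightarrow> e i j = 0"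
  shows "det (mat (Suc r) (Suc r) (\<lambda>(i, j). if i = r then v j else e i j)) =
    (\<Sum>s\<le>r. v s * (\<Prod>t\<in>{s..<r}. - e t (Suc t)) * leading_det e s)"
proof (induction r)
  case 0
  show ?case by (simp add: det_single)
next
  case (Suc r)
  define A where "A = mat (Suc (Suc r)) (Suc (Suc r)) (\<lambda>(i, j). if i = Suc r then v j else e i j)"
  have "det A = (\<Sum>i<Suc (Suc r). A $$ (i, Suc r) * cofactor A i (Suc r))"
    by (rule laplace_expansion_column) (auto simp: A_def)
  also have "\<dots> = A $$ (r, Suc r) * cofactor A r (Suc r) + A $$ (Suc r, Suc r) * cofactor A (Suc r) (Suc r)"
    using assms by (simp add: A_def)
  also have "cofactor A (Suc r) (Suc r) = leading_det e (Suc r)"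
    unfolding cofactor_def leading_det_def
    by (auto simp: A_def mat_delete_def simp flip: mult_2 intro!: arg_cong[of _ _ det])
  also have "cofactor A r (Suc r) =
      - det (mat (Suc r) (Suc r) (\<lambda>(i, j). if i = r then v j else e i j))"
    unfolding cofactor_def
    by (auto simp: A_def mat_delete_def simp flip: mult_2 intro!: arg_cong[of _ _ det])
  also have "A $$ (r, Suc r) = e r (Suc r)"
    by (simp add: A_def)
  also have "A $$ (Suc r, Suc r) = v (Suc r)"
    by (simp add: A_def)
  finally show ?case
    unfolding Suc.IH A_def by (simp add: sum_distrib_left mult_ac sum_negf)
qed

lemma leading_det_Suc:
  assumes "\<And>i j. Suc i < j \<Longrightarrow> e i j = 0"
  shows "leading_det e (Suc r) =
    (\<Sum>s\<le>r. e r s * (\<Prod>t\<in>{s..<r}. - e t (Suc t)) * leading_det e s)"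
proof -
  have "leading_det e (Suc r) =
      det (mat (Suc r) (Suc r) (\<lambda>(i, j). if i = r then e r j else e i j))"
    unfolding leading_det_def by (auto intro!: arg_cong[of _ _ det])
  then show ?thesis
    using det_hessenberg_last_row[of e r "e r"] assms by simp
qed

lemma leading_det_cong:
  assumes "\<And>i j. i < r \<Longrightarrow> j < r \<Longrightarrow> e i j = e' i j"
  shows "leading_det e r = leading_det e' r"
  unfolding leading_det_def using assms by (auto intro!: arg_cong[of _ _ det])

text \<open>Evaluation respects the sums and products of the Hessenberg recursion.\<close>

lemma leading_det_hessenberg_poly:
  fixes e :: "nat \<Rightarrow> nat \<Rightarrow> 'a::comm_ring_1 poly"
  assumes "\<And>i j. Suc i < j \<Longrightarrow> e i j = 0"
  shows "poly (leading_det e r) k = leading_det (\<lambda>i j. poly (e i j) k) r"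
proof (induction r rule: less_induct)
  case (less r)
  show ?case
  proof (cases r)
    case (Suc r')
    show ?thesis
      unfolding Suc using less Suc assms
      by (simp add: leading_det_Suc poly_sum poly_prod)
  qed simp
qed

text \<open>The bounds need not be attained: if one is strict, both sides vanish.\<close>

lemma coeff_mult_degree_le:
  assumes "degree p \<le> a" "degree q \<le> b"
  shows "coeff (p * q) (a + b) = coeff p a * coeff q b"
proof (cases "degree p = a \<and> degree q = b")
  case True
  then show ?thesis using coeff_mult_degree_sum[of p q] by simp
next
  case False
  then have "degree p + degree q < a + b" using assms by auto
  then have "degree (p * q) < a + b"
    using degree_mult_le[of p q] by linarith
  then have "coeff (p * q) (a + b) = 0"
    by (rule coeff_eq_0)
  moreover have "coeff p a = 0 \<or> coeff q b = 0"
    using False assms by (metis coeff_eq_0 le_neq_implies_less)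
  ultimately show ?thesis by auto
qed

text \<open>The superdiagonal factors are constant polynomials, so summand \<open>s\<close> of the
  recursion has degree at most \<open>d + d * s\<close>. Only the last one, diagonal entry times
  previous minor, can reach \<open>d * r\<close>.\<close>

lemma leading_det_hessenberg_degree:
  fixes e :: "nat \<Rightarrow> nat \<Rightarrow> 'a::comm_ring_1 poly"
  assumes "\<And>i j. Suc i < j \<Longrightarrow> e i j = 0"
    and "\<And>i. i < r \<Longrightarrow> degree (e i (Suc i)) = 0"
    and "\<And>i j. i < r \<Longrightarrow> degree (e i j) \<le> d"
    and "\<And>i. i < r \<Longrightarrow> coeff (e i i) d = c"
    and "d > 0"
  shows "degree (leading_det e r) \<le> d * r \<and> coeff (leading_det e r) (d * r) = c ^ r"
  using assms(2-4)
proof (induction r rule: less_induct)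
  case (less r)
  show ?case
  proof (cases r)
    case (Suc q)
    have rec: "leading_det e (Suc q) = (\<Sum>s\<le>q. e q s * (\<Prod>t\<in>{s..<q}. - e t (Suc t)) * leading_det e s)"
      using assms(1) by (rule leading_det_Suc)
    let ?t = "\<lambda>s. e q s * (\<Prod>t\<in>{s..<q}. - e t (Suc t)) * leading_det e s"
    have deg: "degree (?t s) \<le> d + d * s" if "s \<le> q" for s
    proof -
      have "degree (\<Prod>t\<in>{s..<q}. - e t (Suc t)) \<le> (\<Sum>t\<in>{s..<q}. degree (- e t (Suc t)))"
        using degree_prod_sum_le[of "{s..<q}" "\<lambda>t. - e t (Suc t)"] by (simp add: comp_def)
      also have "\<dots> = 0"
        using less.prems(1) Suc by simp
      finally have "degree (\<Prod>t\<in>{s..<q}. - e t (Suc t)) = 0" by simp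
      moreover have "degree (e q s) \<le> d" "degree (leading_det e s) \<le> d * s"
        using less that Suc by auto
      moreover have "degree (?t s) \<le> degree (e q s) + degree (\<Prod>t\<in>{s..<q}. - e t (Suc t)) + degree (leading_det e s)"
        by (meson degree_mult_le add_mono le_refl order_trans)
      ultimately show ?thesis by linarith
    qed
    have eq: "leading_det e r = (\<Sum>s<q. ?t s) + e q q * leading_det e q"
      unfolding Suc rec by (simp add: lessThan_Suc_atMost[symmetric])
    have lt: "degree (?t s) < d * r" if "s < q" for s
    proof -
      have "d * Suc s < d * r"
        using that Suc \<open>d > 0\<close> by simp
      then show ?thesis using deg[of s] that by simp
    qed
    have "coeff (\<Sum>s<q. ?t s) (d * r) = 0"
      unfolding coeff_sum using lt by (intro sum.neutral) (auto intro: coeff_eq_0)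
    moreover have "coeff (e q q * leading_det e q) (d + d * q) = c * c ^ q"
    proof -
      have "degree (e q q) \<le> d" "coeff (e q q) d = c"
         "degree (leading_det e q) \<le> d * q" "coeff (leading_det e q) (d * q) = c ^ q"
        using less Suc by auto
      then show ?thesis
        by (simp add: coeff_mult_degree_le)
    qed
    moreover have "degree (leading_det e r) \<le> d * r"
      unfolding Suc rec
      using deg by (intro degree_sum_le) (auto intro!: order_trans[OF deg])
    ultimately show ?thesis
      unfolding eq by (simp add: Suc)
  qed simp
qed

text \<open>\<open>x\<close> and \<open>z\<close> share a column, \<open>y\<close> and
  \<open>z\<close> a row. Up to sign, \<open>x * y\<close> is multiplied by a minor that is strictly
  lower triangular, hence zero, unless \<open>N = 0\<close>, where it is empty and equals 1;
  \<open>y0\<close> covers that case.\<close>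

lemma leading_det_hessenberg_perturb:
  fixes e e' :: "nat \<Rightarrow> nat \<Rightarrow> 'a::comm_ring_1"
  assumes hess: "\<And>i j. Suc i < j \<Longrightarrow> e i j = 0" "\<And>i j. Suc i < j \<Longrightarrow> e' i j = 0"
    and eq: "\<And>i j. i < j + N \<Longrightarrow> e' i j = e i j"
    and x: "e' N 0 = e N 0 + x"
    and y: "e' (Suc N) 1 = e (Suc N) 1 + y"
    and z: "e' (Suc N) 0 = e (Suc N) 0 + z"
    and y0: "N = 0 \<Longrightarrow> y = 0"
  shows "leading_det e' (Suc (Suc N)) = leading_det e (Suc (Suc N))
    + x * ((\<Prod>t<N. - e t (Suc t)) * e (Suc N) (Suc N))
    + y * ((\<Prod>t\<in>{1..<Suc N}. - e t (Suc t)) * leading_det e 1)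
    + z * (\<Prod>t<Suc N. - e t (Suc t))"
proof -
  have rec: "leading_det f (Suc r) = (\<Sum>s\<le>r. f r s * (\<Prod>t\<in>{s..<r}. - f t (Suc t)) * leading_det f s)"
    if "f \<in> {e, e'}" for f r
    using that hess by (intro leading_det_Suc) auto
  note rec = rec[of e, simplified] rec[of e', simplified]
  have sup: "e' t (Suc t) = e t (Suc t)" for t
    by (simp add: eq)
  have small: "leading_det e' s = leading_det e s" if "s \<le> N" for s
    by (rule leading_det_cong) (use that eq in auto)
  \<comment> \<open>The minor one size smaller meets only the change \<open>x\<close>, in column 0
    of its last row.\<close>
  have mid: "leading_det e' (Suc N) = leading_det e (Suc N) + x * (\<Prod>t<N. - e t (Suc t))"
  proof -
    have "leading_det e' (Suc N) = (\<Sum>s\<le>N. e N s * (\<Prod>t\<in>{s..<N}. - e t (Suc t)) * leading_det e s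
        + (if s = 0 then x * (\<Prod>t<N. - e t (Suc t)) else 0))"
      unfolding rec(2) sup
    proof (rule sum.cong)
      fix s assume "s \<in> {..N}"
      then show "e' N s * (\<Prod>t\<in>{s..<N}. - e t (Suc t)) * leading_det e' s =
          e N s * (\<Prod>t\<in>{s..<N}. - e t (Suc t)) * leading_det e s
            + (if s = 0 then x * (\<Prod>t<N. - e t (Suc t)) else 0)"
        by (cases "s = 0") (auto simp: x eq small atLeast0LessThan algebra_simps)
    qed simp
    then show ?thesis
      by (simp add: sum.distrib rec(1))
  qed
  let ?X = "x * ((\<Prod>t<N. - e t (Suc t)) * e (Suc N) (Suc N))"
  let ?Y = "y * ((\<Prod>t\<in>{1..<Suc N}. - e t (Suc t)) * leading_det e 1)"
  let ?Z = "z * (\<Prod>t<Suc N. - e t (Suc t))"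
  have "leading_det e' (Suc (Suc N)) =
      (\<Sum>s\<le>Suc N. e (Suc N) s * (\<Prod>t\<in>{s..<Suc N}. - e t (Suc t)) * leading_det e s
        + (if s = Suc N then ?X else 0) + (if s = 1 then ?Y else 0) + (if s = 0 then ?Z else 0))"
    unfolding rec(2) sup
  proof (rule sum.cong)
    fix s assume "s \<in> {..Suc N}"
    \<comment> \<open>Summand \<open>Suc N\<close> picks up \<open>x\<close> through the smaller
      minor, summand 1 holds \<open>y\<close>, summand 0 holds \<open>z\<close>. For
      \<open>N = 0\<close> the first two coincide.\<close>
    then consider "s = 0" | "s = 1" "N = 0" | "s = 1" "N > 0" | "s > 1" "s \<le> N" | "s > 1" "s = Suc N"
      by fastforce
    then show "e' (Suc N) s * (\<Prod>t\<in>{s..<Suc N}. - e t (Suc t)) * leading_det e' s =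
        e (Suc N) s * (\<Prod>t\<in>{s..<Suc N}. - e t (Suc t)) * leading_det e s
          + (if s = Suc N then ?X else 0) + (if s = 1 then ?Y else 0) + (if s = 0 then ?Z else 0)"
    proof cases
      case 1
      then show ?thesis by (simp add: z atLeast0LessThan algebra_simps del: prod.lessThan_Suc prod.op_ivl_Suc)
    next
      case 2
      then show ?thesis using y y0 mid by (simp add: algebra_simps)
    next
      case 3
      then show ?thesis using y by (simp add: small algebra_simps)
    next
      case 4
      then show ?thesis by (simp add: small eq)
    next
      case 5
      then show ?thesis by (simp add: mid eq algebra_simps)
    qed
  qed simp
  also have "\<dots> = leading_det e (Suc (Suc N)) + ?X + ?Y + ?Z"
    unfolding rec(1)[of "Suc N"] sum.distrib
    by (simp add: sum.delta del: sum.atMost_Suc prod.lessThan_Suc prod.op_ivl_Suc)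
  finally show ?thesis .
qed

section \<open>Vieta's formulas\<close>

lemma coeff_prod_roots:
  fixes \<kappa> :: "nat \<Rightarrow> complex"
  assumes "j \<le> N"
  shows "coeff (\<Prod>i\<in>{1..N}. [:- \<kappa> i, 1:]) (N - j) = (-1) ^ j * elem_sym N \<kappa> j"
proof -
  have "(\<Prod>i\<in>{1..N}. [:- \<kappa> i, 1:]) = (\<Prod>i\<in>{1..N}. [:- \<kappa> i:] + monom 1 1)"
    by (simp add: monom_altdef)
  \<comment> \<open>\<open>I\<close> is the set of factors that contribute a root; the others
    contribute the variable.\<close>
  also have "\<dots> = (\<Sum>I\<in>Pow {1..N}. (\<Prod>i\<in>I. [:- \<kappa> i:]) * (\<Prod>i\<in>{1..N} - I. monom 1 1))"
    by (rule prod_add) simp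
  also have "\<dots> = (\<Sum>I\<in>Pow {1..N}. monom ((-1) ^ card I * (\<Prod>i\<in>I. \<kappa> i)) (N - card I))"
  proof (rule sum.cong)
    fix I assume "I \<in> Pow {1..N}"
    then have I: "finite I" "I \<subseteq> {1..N}" by (auto intro: finite_subset)
    have "(\<Prod>i\<in>I. [:- \<kappa> i:]) = [:\<Prod>i\<in>I. - \<kappa> i:]"
      using I(1) by induction auto
    then show "(\<Prod>i\<in>I. [:- \<kappa> i:]) * (\<Prod>i\<in>{1..N} - I. monom 1 1) =
        monom ((-1) ^ card I * (\<Prod>i\<in>I. \<kappa> i)) (N - card I)"
      using I by (simp add: card_Diff_subset monom_power smult_monom prod_uminus)
  qed simp
  finally have "coeff (\<Prod>i\<in>{1..N}. [:- \<kappa> i, 1:]) (N - j) =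
      (\<Sum>I\<in>Pow {1..N}. if N - card I = N - j then (-1) ^ card I * (\<Prod>i\<in>I. \<kappa> i) else 0)"
    by (simp add: coeff_sum)
  also have "\<dots> = (\<Sum>I\<in>Pow {1..N}. if card I = j then (-1) ^ j * (\<Prod>i\<in>I. \<kappa> i) else 0)"
  proof (rule sum.cong)
    fix I assume "I \<in> Pow {1..N}"
    \<comment> \<open>Subtraction from \<open>N\<close> is injective only on numbers up to
      \<open>N\<close>.\<close>
    then have "card I \<le> N"
      using card_mono[of "{1..N}" I] by auto
    then have "N - card I = N - j \<longleftrightarrow> card I = j"
      using assms by auto
    then show "(if N - card I = N - j then (-1) ^ card I * (\<Prod>i\<in>I. \<kappa> i) else 0) =
        (if card I = j then (-1) ^ j * (\<Prod>i\<in>I. \<kappa> i) else 0)"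
      by simp
  qed simp
  also have "\<dots> = (\<Sum>I\<in>{I \<in> Pow {1..N}. card I = j}. (-1) ^ j * (\<Prod>i\<in>I. \<kappa> i))"
    by (rule sum.inter_filter[symmetric]) simp
  also have "\<dots> = (-1) ^ j * elem_sym N \<kappa> j"
    by (simp add: elem_sym_def Pow_def sum_distrib_left)
  finally show ?thesis .
qed

text \<open>Over the complex numbers \<open>P\<close> splits into linear factors.\<close>

lemma coeff_eq_elem_sym_roots:
  assumes "enumerates_roots P N \<kappa>" "degree P = N" "j \<le> N"
  shows "coeff P (N - j) = lead_coeff P * ((-1) ^ j * elem_sym N \<kappa> j)"
proof -
  have "P = smult (lead_coeff P) (\<Prod>x\<in>#proots P. [:- x, 1:])"
    by (rule complex_poly_decompose_multiset[symmetric])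
  also have "(\<Prod>x\<in>#proots P. [:- x, 1:]) = (\<Prod>i\<in>{1..N}. [:- \<kappa> i, 1:])"
    using assms(1) unfolding enumerates_roots_def
    by (metis (no_types, lifting) image_mset.compositionality comp_def prod_unfold_prod_mset image_mset_cong)
  finally show ?thesis
    using coeff_prod_roots[OF assms(3)] by (metis coeff_smult)
qed

section \<open>Expansions at the horizon\<close>

lemma expands_at_horizon_shift:
  "expands_at_horizon g c \<longleftrightarrow> (\<forall>\<^sub>F x in nhds 0. (\<lambda>j. x ^ j *\<^sub>R c j) sums g (1 + x))"
proof -
  have "nhds (1::real) = filtermap (\<lambda>x. 1 + x) (nhds 0)"
    using filtermap_nhds_shift[of "-1" "0::real"] by (simp add: add.commute)
  then show ?thesis
    unfolding expands_at_horizon_def by (simp add: eventually_filtermap)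
qed

text \<open>Convergence at a single nonzero offset already forces a positive radius of convergence.
  This opens the calculus of formal power series in \<open>x = z - 1\<close>.\<close>

lemma expands_at_horizon_iff_fps:
  fixes g :: "real \<Rightarrow> real"
  shows "expands_at_horizon g c \<longleftrightarrow> (\<lambda>x. g (1 + x)) has_fps_expansion Abs_fps c"
proof
  assume "expands_at_horizon g c"
  then have ev: "\<forall>\<^sub>F x in nhds 0. (\<lambda>j. c j * x ^ j) sums g (1 + x)"
    by (simp add: expands_at_horizon_shift mult.commute)
  then obtain d where d: "d > 0" "\<And>x. dist x 0 < d \<Longrightarrow> (\<lambda>j. c j * x ^ j) sums g (1 + x)"
    unfolding eventually_nhds_metric by blast
  have "summable (\<lambda>j. c j * (d / 2) ^ j)"
    using d(2)[of "d / 2"] d(1) by (auto dest: sums_summable)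
  then have "conv_radius c \<ge> norm (d / 2)"
    by (rule conv_radius_geI)
  with d(1) have "fps_conv_radius (Abs_fps c) > 0"
    using less_le_trans[of 0 "ereal (norm (d / 2))" "conv_radius c"]
    by (simp add: fps_conv_radius_def)
  moreover have "\<forall>\<^sub>F x in nhds 0. eval_fps (Abs_fps c) x = g (1 + x)"
    using ev by eventually_elim (simp add: eval_fps_def sums_iff)
  ultimately show "(\<lambda>x. g (1 + x)) has_fps_expansion Abs_fps c"
    by (simp add: has_fps_expansion_def)
next
  assume *: "(\<lambda>x. g (1 + x)) has_fps_expansion Abs_fps c"
  then have "\<forall>\<^sub>F x in nhds 0. x \<in> eball 0 (fps_conv_radius (Abs_fps c))"
    by (intro eventually_nhds_in_open) (auto simp: has_fps_expansion_def zero_ereal_def)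
  moreover have "\<forall>\<^sub>F x in nhds 0. eval_fps (Abs_fps c) x = g (1 + x)"
    using * by (simp add: has_fps_expansion_def)
  ultimately have "\<forall>\<^sub>F x in nhds 0. (\<lambda>j. x ^ j *\<^sub>R c j) sums g (1 + x)"
  proof eventually_elim
    case (elim x)
    then show ?case
      using sums_eval_fps[of x "Abs_fps c"] by (simp add: mult.commute)
  qed
  then show "expands_at_horizon g c"
    by (simp add: expands_at_horizon_shift)
qed

lemma expands_at_horizon_diff:
  "expands_at_horizon g c \<Longrightarrow> expands_at_horizon h d \<Longrightarrow>
    expands_at_horizon (\<lambda>z. g z - h z) (\<lambda>j. c j - d j)"
  unfolding expands_at_horizon_def
  by (erule (1) eventually_elim2) (simp add: scaleR_diff_right sums_diff)

lemma expands_at_horizon_add: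
  "expands_at_horizon g c \<Longrightarrow> expands_at_horizon h d \<Longrightarrow>
    expands_at_horizon (\<lambda>z. g z + h z) (\<lambda>j. c j + d j)"
  unfolding expands_at_horizon_def
  by (erule (1) eventually_elim2) (simp add: scaleR_add_right sums_add)

lemma expands_at_horizon_bounded_linear:
  assumes "bounded_linear f" "expands_at_horizon g c"
  shows "expands_at_horizon (\<lambda>z. f (g z)) (\<lambda>j. f (c j))"
proof -
  interpret bounded_linear f by fact
  show ?thesis
    using assms(2) unfolding expands_at_horizon_def
    by eventually_elim (use sums in \<open>fastforce simp: scaleR\<close>)
qed

lemma expands_at_horizon_0:
  fixes c :: "nat \<Rightarrow> real"
  assumes "expands_at_horizon (\<lambda>z. 0) c"
  shows "c = (\<lambda>j. 0)"
proof
  have "\<forall>\<^sub>F x in nhds 0. (\<lambda>j. c j * x ^ j) sums 0"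
    using assms by (simp add: expands_at_horizon_shift mult.commute)
  then obtain r where r: "r > 0" "\<And>x. dist x 0 < r \<Longrightarrow> (\<lambda>j. c j * x ^ j) sums 0"
    unfolding eventually_nhds_metric by blast
  show "c j = 0" for j
  proof (induction j rule: less_induct)
    case (less j)
    \<comment> \<open>With the coefficients below \<open>j\<close> gone, the series can be divided
      by \<open>x ^ j\<close>; its limit at 0 then isolates \<open>c j\<close>.\<close>
    have "(\<lambda>i. c (i + j) * x ^ i) sums 0" if "x \<noteq> 0" "norm x < r" for x
    proof -
      have "(\<lambda>i. c (i + j) * x ^ (i + j)) sums (0 - (\<Sum>i<j. c i * x ^ i))"
        using r(2)[of x] that by (intro sums_split_initial_segment) simp
      then have "(\<lambda>i. c (i + j) * x ^ (i + j)) sums 0"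
        using less by simp
      from sums_divide[OF this, of "x ^ j"] show ?thesis
        using that by (simp add: power_add)
    qed
    then have "((\<lambda>x::real. 0) \<longlongrightarrow> c (0 + j)) (at 0)"
      by (rule powser_limit_0_strong[OF r(1)])
    then show ?case
      by (simp add: tendsto_const_iff)
  qed
qed

lemma expands_at_horizon_unique_real:
  fixes c d :: "nat \<Rightarrow> real"
  assumes "expands_at_horizon g c" "expands_at_horizon g d"
  shows "c = d"
  using expands_at_horizon_0[of "\<lambda>j. c j - d j"] expands_at_horizon_diff[OF assms]
  by (auto simp: fun_eq_iff)

text \<open>Real and imaginary parts reduce this to real expansions.\<close>

lemma expands_at_horizon_unique_complex:
  fixes c d :: "nat \<Rightarrow> complex"
  assumes "expands_at_horizon g c" "expands_at_horizon g d"
  shows "c = d"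
  using expands_at_horizon_unique_real[OF assms[THEN expands_at_horizon_bounded_linear[OF bounded_linear_Re]]]
    expands_at_horizon_unique_real[OF assms[THEN expands_at_horizon_bounded_linear[OF bounded_linear_Im]]]
  by (auto simp: fun_eq_iff complex_eq_iff)

lemma hcoeff_real:
  fixes g :: "real \<Rightarrow> real"
  assumes "expands_at_horizon g c"
  shows "hcoeff g = c"
  unfolding hcoeff_def
  by (rule the_equality) (use assms expands_at_horizon_unique_real in blast)+

lemma hcoeff_complex:
  fixes g :: "real \<Rightarrow> complex"
  assumes "expands_at_horizon g c"
  shows "hcoeff g = c"
  unfolding hcoeff_def
  by (rule the_equality) (use assms expands_at_horizon_unique_complex in blast)+

lemma expands_at_horizon_at_1:
  assumes "expands_at_horizon g c"
  shows "c 0 = g 1"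
proof -
  have "(\<lambda>j. 0 ^ j *\<^sub>R c j) sums g 1"
    using eventually_nhds_x_imp_x[OF assms[unfolded expands_at_horizon_def]] by simp
  moreover have "(\<lambda>j. 0 ^ j *\<^sub>R c j) sums (\<Sum>j\<in>{0}. 0 ^ j *\<^sub>R c j)"
    by (rule sums_finite) auto
  ultimately show ?thesis
    using sums_unique2 by fastforce
qed

definition horizon_fps :: "(real \<Rightarrow> real) \<Rightarrow> real fps" where
  "horizon_fps g = Abs_fps (hcoeff g)"

lemma analytic_at_horizon_fps:
  fixes g :: "real \<Rightarrow> real"
  assumes "analytic_at_horizon g"
  shows "(\<lambda>x. g (1 + x)) has_fps_expansion horizon_fps g"
  using assms by (auto simp: analytic_at_horizon_def horizon_fps_def hcoeff_real
      simp flip: expands_at_horizon_iff_fps)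

lemma hcoeff_fps:
  assumes "(\<lambda>x. g (1 + x)) has_fps_expansion F"
  shows "expands_at_horizon g (fps_nth F)" "hcoeff g = fps_nth F"
  using assms by (auto simp: expands_at_horizon_iff_fps fps_nth_inverse intro!: hcoeff_real)

section \<open>Expansions of the coefficient functions of the radial equation\<close>

lemma has_fps_expansion_inverse_shift:
  "(\<lambda>x::real. inverse (1 + x)) has_fps_expansion inverse (1 + fps_X)"
  by (intro fps_expansion_intros) auto

lemma hcoeff_A_fun:
  assumes "analytic_at_horizon f1" "analytic_at_horizon f2"
  shows "hcoeff (A_fun f1 f2) = fps_nth (horizon_fps f1 * horizon_fps f2)"
  unfolding A_fun_def
  by (intro hcoeff_fps has_fps_expansion_mult analytic_at_horizon_fps assms)

lemma hcoeff_B_fun: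
  assumes "analytic_at_horizon f1" "analytic_at_horizon f2"
  defines "F \<equiv> horizon_fps f1 * horizon_fps f2"
  shows "hcoeff (B_fun f1 f2) = fps_nth (fps_const (1/2) * fps_deriv F - F * inverse (1 + fps_X))"
proof (rule hcoeff_fps(2))
  have F: "(\<lambda>x. f1 (1 + x) * f2 (1 + x)) has_fps_expansion F"
    unfolding F_def by (intro has_fps_expansion_mult analytic_at_horizon_fps assms)
  have d: "deriv (\<lambda>x. f1 (1 + x) * f2 (1 + x)) = (\<lambda>x. deriv (\<lambda>x. f1 x * f2 x) (1 + x))"
    by (auto simp: fun_eq_iff deriv_def DERIV_shift add.commute)
  have "(\<lambda>x. 1/2 * deriv (\<lambda>x. f1 x * f2 x) (1 + x) - (f1 (1 + x) * f2 (1 + x)) * inverse (1 + x)) has_fps_expansion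
      fps_const (1/2) * fps_deriv F - F * inverse (1 + fps_X)"
    using has_fps_expansion_diff[OF has_fps_expansion_cmult_left[OF has_fps_expansion_deriv[OF F], of "1/2"]
        has_fps_expansion_mult[OF F has_fps_expansion_inverse_shift]]
    unfolding d .
  moreover have "(\<lambda>x. B_fun f1 f2 (1 + x)) =
      (\<lambda>x. 1/2 * deriv (\<lambda>x. f1 x * f2 x) (1 + x) - (f1 (1 + x) * f2 (1 + x)) * inverse (1 + x))"
    by (rule ext) (simp add: B_fun_def inverse_eq_divide)
  ultimately show "(\<lambda>x. B_fun f1 f2 (1 + x)) has_fps_expansion
      fps_const (1/2) * fps_deriv F - F * inverse (1 + fps_X)"
    by (simp only:)
qed

text \<open>The angular velocity cancels: \<open>\<omega> - k * f3\<close> equals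
  \<open>w - k * (f3 - f3 1)\<close>. Expanding the square sorts the coefficient by powers of
  \<open>k\<close>.\<close>

lemma hcoeff_C_fun:
  assumes "analytic_at_horizon f1" "analytic_at_horizon f3"
  defines "F \<equiv> horizon_fps f1" and "G \<equiv> horizon_fps f3 - fps_const (f3 1)"
  shows "hcoeff (C_fun f1 f3 m (w + k * of_real (f3 1)) k) j =
     (if j = 0 then w\<^sup>2 else 0) - 2 * w * k * of_real (fps_nth G j)
     + k\<^sup>2 * (of_real (fps_nth (G\<^sup>2) j) - of_real (fps_nth F j))
     - m\<^sup>2 * of_real (fps_nth (F * inverse (1 + fps_X) ^ 2) j)"
proof -
  have mult_of_real: "expands_at_horizon (\<lambda>z. a * of_real (g z)) (\<lambda>j. a * of_real (fps_nth H j))"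
    if "(\<lambda>x. g (1 + x)) has_fps_expansion H" for a :: complex and g H
    by (rule expands_at_horizon_bounded_linear[OF _ hcoeff_fps(1)[OF that]])
       (intro bounded_linear_const_mult bounded_linear_of_real)
  have F: "(\<lambda>x. f1 (1 + x)) has_fps_expansion F"
    unfolding F_def by (intro analytic_at_horizon_fps assms)
  have G: "(\<lambda>x. f3 (1 + x) - f3 1) has_fps_expansion G"
    unfolding G_def by (intro has_fps_expansion_diff has_fps_expansion_const analytic_at_horizon_fps assms)
  have G2: "(\<lambda>x. (f3 (1 + x) - f3 1)\<^sup>2) has_fps_expansion G\<^sup>2"
    unfolding power2_eq_square by (intro has_fps_expansion_mult G)
  have FI: "(\<lambda>x. f1 (1 + x) * (inverse (1 + x))\<^sup>2) has_fps_expansion F * (inverse (1 + fps_X))\<^sup>2"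
    unfolding power2_eq_square by (intro has_fps_expansion_mult F has_fps_expansion_inverse_shift)
  have W: "(\<lambda>x::real. 1) has_fps_expansion 1"
    by simp
  define h where "h z = w\<^sup>2 * of_real 1 - 2 * w * k * of_real (f3 z - f3 1)
      + (k\<^sup>2 * of_real ((f3 z - f3 1)\<^sup>2) - k\<^sup>2 * of_real (f1 z))
      - m\<^sup>2 * of_real (f1 z * (inverse z)\<^sup>2)" for z
  have eq: "C_fun f1 f3 m (w + k * of_real (f3 1)) k z = h z" if "z \<noteq> 0" for z
  proof -
    have "(k\<^sup>2 * of_real (z\<^sup>2) + m\<^sup>2) / of_real (z\<^sup>2) = k\<^sup>2 + m\<^sup>2 * of_real ((inverse z)\<^sup>2)"
      using that by (simp add: add_divide_distrib inverse_eq_divide power_divide)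
    moreover have "(w + k * c - k * b)\<^sup>2 - a * (k\<^sup>2 + m\<^sup>2 * q) =
        w\<^sup>2 * 1 - 2 * w * k * (b - c) + (k\<^sup>2 * (b - c)\<^sup>2 - k\<^sup>2 * a) - m\<^sup>2 * (a * q)"
      for a b c q :: complex
      by (simp add: power2_eq_square algebra_simps)
    ultimately show ?thesis
      unfolding C_fun_def h_def by (simp only: of_real_1 of_real_mult of_real_diff of_real_power)
  qed
  have "expands_at_horizon h (\<lambda>j. w\<^sup>2 * of_real (fps_nth 1 j) - 2 * w * k * of_real (fps_nth G j)
      + (k\<^sup>2 * of_real (fps_nth (G\<^sup>2) j) - k\<^sup>2 * of_real (fps_nth F j))
      - m\<^sup>2 * of_real (fps_nth (F * (inverse (1 + fps_X))\<^sup>2) j))"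
    unfolding h_def
    by (intro expands_at_horizon_add expands_at_horizon_diff mult_of_real W G G2 F FI)
  \<comment> \<open>Cancelling \<open>z^2\<close> against \<open>z^2\<close> requires nonzero
    \<open>z\<close>, which holds near 1.\<close>
  moreover have "\<forall>\<^sub>F z in nhds 1. C_fun f1 f3 m (w + k * of_real (f3 1)) k z = h z"
    using t1_space_nhds[of 1 "0::real"] by (rule eventually_mono) (auto intro: eq)
  ultimately have "expands_at_horizon (C_fun f1 f3 m (w + k * of_real (f3 1)) k)
      (\<lambda>j. w\<^sup>2 * of_real (fps_nth 1 j) - 2 * w * k * of_real (fps_nth G j)
      + (k\<^sup>2 * of_real (fps_nth (G\<^sup>2) j) - k\<^sup>2 * of_real (fps_nth F j))
      - m\<^sup>2 * of_real (fps_nth (F * (inverse (1 + fps_X))\<^sup>2) j))"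
    unfolding expands_at_horizon_def
  proof eventually_elim
    case (elim z)
    then show ?case by (simp only:)
  qed
  then show ?thesis
    by (simp add: hcoeff_complex right_diff_distrib del: fps_mult_nth_0)
qed

section \<open>The pole-skipping matrix\<close>

text \<open>With \<open>d = K - S + 1\<close> and \<open>\<sigma> = \<rho> + S - 1\<close>, expressing \<open>B\<close> through \<open>A = f1 f2\<close> combines the
  two multiples of \<open>A\<^sub>d\<^sub>+\<^sub>2\<close> into \<open>\<sigma> (\<sigma> - 1) + \<sigma> (d + 2) / 2 = \<sigma> (K + S - 1 - n) / 2\<close>. Here \<open>K = Suc i\<close>,
  \<open>S = Suc j\<close>, and \<open>G\<close> is the expansion of \<open>f3 - f3 1\<close>.\<close>

definition skip_entry ::
  "nat \<Rightarrow> complex \<Rightarrow> complex \<Rightarrow> real fps \<Rightarrow> real fps \<Rightarrow> real fps \<Rightarrow> nat \<Rightarrow> nat \<Rightarrow> complex poly" where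
  "skip_entry n w m F1 F2 G i j = (if Suc i < j then 0 else
     (let d = Suc i - j; \<sigma> = of_nat j - of_nat n / 2; I = inverse (1 + fps_X)
      in [: of_real (fps_nth (F1 * F2) (d + 2)) * (\<sigma> * (of_nat (Suc i) + of_nat j - of_nat n) / 2)
            - \<sigma> * of_real (fps_nth (F1 * F2 * I) (Suc d))
            + (if d = 0 then w\<^sup>2 else 0) - m\<^sup>2 * of_real (fps_nth (F1 * I\<^sup>2) d),
          - 2 * w * of_real (fps_nth G d),
          of_real (fps_nth (G\<^sup>2) d) - of_real (fps_nth F1 d) :]))"

lemma skip_entry_eq_0: "Suc i < j \<Longrightarrow> skip_entry n w m F1 F2 G i j = 0"
  by (simp add: skip_entry_def)

lemma M_entry_eq:
  assumes "rotating_black_hole f1 f2 f3 T"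
  shows "M_entry f1 f2 f3 T m (w_skip T n) k (Suc i) (Suc j) =
    poly (skip_entry n (w_skip T n) m (horizon_fps f1) (horizon_fps f2)
      (horizon_fps f3 - fps_const (f3 1)) i j) k"
proof -
  have T: "T > 0" and an: "analytic_at_horizon f1" "analytic_at_horizon f2" "analytic_at_horizon f3"
    using assms by (auto simp: rotating_black_hole_def)
  have rho: "- \<i> * w_skip T n / of_real (4 * pi * T) = - of_nat n / 2"
    using T by (simp add: w_skip_def field_simps)
  show ?thesis
  proof (cases "Suc i < j")
    \<comment> \<open>The offsets 3, 2, 1 match the lowest orders 2, 1, 0, so all three coefficients
      fall below their lowest order together.\<close>
    case True
    then show ?thesis
      by (simp add: M_entry_def hcoeff_from_def skip_entry_eq_0)
  next
    case False
    then obtain d where d: "Suc i = j + d"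
      by (metis le_Suc_ex not_less)
    have idx: "int (Suc i) - int (Suc j) + 3 = int (d + 2)"
      "int (Suc i) - int (Suc j) + 2 = int (d + 1)"
      "int (Suc i) - int (Suc j) + 1 = int d"
      using d by auto
    have hc: "hcoeff_from 2 g (int (d + 2)) = hcoeff g (d + 2)" 
      "hcoeff_from 1 g (int (d + 1)) = hcoeff g (d + 1)" 
      "hcoeff_from 0 h (int d) = hcoeff h d" for g :: "real \<Rightarrow> real" and h :: "real \<Rightarrow> complex"
      by (auto simp: hcoeff_from_def nat_add_distrib)
    have i: "(of_nat (Suc i) :: complex) = of_nat j + of_nat d" "(of_nat (Suc j) :: complex) = of_nat j + 1"
      using d by simp_all
    have d': "Suc i - j = d" using d by simp
    have B: "fps_nth (fps_const (1/2) * fps_deriv F - F * I) (d + 1) =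
        (real d + 2) / 2 * fps_nth F (d + 2) - fps_nth (F * I) (Suc d)" for F I :: "real fps"
      by simp
    have key: "a * ((- of_nat n / 2 + (of_nat j + 1) - 1) * (- of_nat n / 2 + (of_nat j + 1) - 2))
        + ((of_nat d + 2) / 2 * a - b) * (- of_nat n / 2 + (of_nat j + 1) - 1)
        + (c0 - 2 * w * k * g + k\<^sup>2 * (g2 - f) - m\<^sup>2 * c) =
        poly [:a * ((of_nat j - of_nat n / 2) * (of_nat j + of_nat d + of_nat j - of_nat n) / 2)
          - (of_nat j - of_nat n / 2) * b + c0 - m\<^sup>2 * c, - 2 * w * g, g2 - f:] k"
      for a b c0 w k g g2 f c :: complex
      by (simp add: field_simps power2_eq_square)
    show ?thesis
      unfolding M_entry_def Let_def rho idx hc skip_entry_def d' hcoeff_A_fun[OF an(1,2)]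
        hcoeff_B_fun[OF an(1,2)] hcoeff_C_fun[OF an(1,3)] i B if_not_P[OF False]
      by (simp only: key of_real_diff of_real_mult of_real_add of_real_divide of_real_of_nat_eq of_real_numeral)
  qed
qed

text \<open>\<open>D\<close> is divisible by \<open>fps_X ^ n\<close>. In use, \<open>D\<close> is
  the difference of two series that agree below order \<open>n\<close>.\<close>

lemma fps_mult_nth_vanishing:
  fixes D g :: "'a::comm_ring_1 fps"
  assumes "\<And>i. i < n \<Longrightarrow> fps_nth D i = 0"
  shows "k < n \<Longrightarrow> fps_nth (D * g) k = 0"
    and "fps_nth (D * g) n = fps_nth D n * fps_nth g 0"
    and "fps_nth (D * g) (Suc n) = fps_nth D n * fps_nth g 1 + fps_nth D (Suc n) * fps_nth g 0"
proof -
  have "D = fps_X ^ n * fps_shift n D"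
    using assms by (auto simp: fps_eq_iff fps_X_power_mult_nth)
  then have eq: "D * g = fps_X ^ n * (fps_shift n D * g)"
    by (metis mult.assoc)
  show "k < n \<Longrightarrow> fps_nth (D * g) k = 0"
    unfolding eq by (simp add: fps_X_power_mult_nth)
  show "fps_nth (D * g) n = fps_nth D n * fps_nth g 0"
    unfolding eq by (simp add: fps_X_power_mult_nth)
  show "fps_nth (D * g) (Suc n) = fps_nth D n * fps_nth g 1 + fps_nth D (Suc n) * fps_nth g 0"
    unfolding eq by (simp add: fps_X_power_mult_nth fps_mult_nth_1 Suc_diff_le)
qed

text \<open>\<open>E1\<close>, \<open>E2\<close>, \<open>H\<close> play the role of \<open>F1\<close>, \<open>F2\<close>, \<open>G\<close> truncated below order \<open>n\<close>.\<close>

lemma skip_entry_change: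
  fixes F1 F2 G E1 E2 H :: "real fps"
  assumes n: "n > 1"
    and low: "\<And>i. i < n \<Longrightarrow> fps_nth F1 i = fps_nth E1 i"
      "\<And>i. i < n \<Longrightarrow> fps_nth F2 i = fps_nth E2 i" "\<And>i. i < n \<Longrightarrow> fps_nth G i = fps_nth H i"
    and zero: "fps_nth E1 0 = 0" "fps_nth E2 0 = 0" "fps_nth H 0 = 0"
    and top: "fps_nth E1 n = 0" "fps_nth E2 n = 0" "fps_nth H n = 0"
  defines "u \<equiv> of_real (fps_nth E1 1 * fps_nth F2 n + fps_nth F1 n * fps_nth E2 1) :: complex"
  shows "Suc i - j < n - 1 \<Longrightarrow> skip_entry n w m F1 F2 G i j = skip_entry n w m E1 E2 H i j"
    and "skip_entry n w m F1 F2 G (n - 2) 0 = skip_entry n w m E1 E2 H (n - 2) 0 + [:u * of_nat n / 4:]"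
    and "skip_entry n w m F1 F2 G (n - 1) 1 = skip_entry n w m E1 E2 H (n - 1) 1 + [:u * (2 - of_nat n) / 4:]"
    and "skip_entry n w m F1 F2 G (n - 1) 0 = skip_entry n w m E1 E2 H (n - 1) 0
      + [:u * of_nat n / 2 - m\<^sup>2 * of_real (fps_nth F1 n), - 2 * w * of_real (fps_nth G n), - of_real (fps_nth F1 n):]"
proof -
  define I :: "real fps" where "I = inverse (1 + fps_X)"
  have I0: "fps_nth I 0 = 1" by (simp add: I_def)
  have D1: "fps_nth (F1 - E1) i = 0" and D2: "fps_nth (F2 - E2) i = 0" and DG: "fps_nth (G - H) i = 0"
    if "i < n" for i
    using low that by auto
  have F20: "fps_nth F2 0 = 0" "fps_nth F2 1 = fps_nth E2 1" and G0: "fps_nth G 0 = 0"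
    using low[of 0] low[of 1] zero n by auto
  \<comment> \<open>Each added product has a factor of order at least \<open>n\<close> and one
    without constant term, so \<open>F1 * F2\<close> first changes at order \<open>n + 1\<close>, by
    \<open>u\<close>.\<close>
  have A: "F1 * F2 = E1 * E2 + ((F1 - E1) * F2 + (F2 - E2) * E1)"
    by (simp add: algebra_simps)
  have A_low: "fps_nth (F1 * F2 - E1 * E2) k = 0" if "k < Suc n" for k
    unfolding A using that fps_mult_nth_vanishing[OF D1] fps_mult_nth_vanishing[OF D2] F20 zero
    by (cases "k = n") auto
  have A_n: "of_real (fps_nth (F1 * F2 - E1 * E2) (Suc n)) = u"
    unfolding A u_def using fps_mult_nth_vanishing(3)[OF D1] fps_mult_nth_vanishing(3)[OF D2] F20 zero top
    by (simp add: mult.commute)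
  have AI: "F1 * F2 * I = E1 * E2 * I + (F1 * F2 - E1 * E2) * I"
    by (simp add: algebra_simps)
  have AI_low: "fps_nth (F1 * F2 * I) k = fps_nth (E1 * E2 * I) k" if "k < Suc n" for k
    unfolding AI using that fps_mult_nth_vanishing(1)[OF A_low] by simp
  have AI_n: "of_real (fps_nth (F1 * F2 * I) (Suc n)) = of_real (fps_nth (E1 * E2 * I) (Suc n)) + u"
    unfolding AI A_n[symmetric] using fps_mult_nth_vanishing(2)[OF A_low, of _ I] I0 by simp
  have FI: "F1 * I\<^sup>2 = E1 * I\<^sup>2 + (F1 - E1) * I\<^sup>2"
    by (simp add: algebra_simps)
  have FI_low: "fps_nth (F1 * I\<^sup>2) k = fps_nth (E1 * I\<^sup>2) k" if "k < n" for k
    unfolding FI using that fps_mult_nth_vanishing(1)[OF D1] by simp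
  have FI_n: "fps_nth (F1 * I\<^sup>2) n = fps_nth (E1 * I\<^sup>2) n + fps_nth F1 n"
    unfolding FI using fps_mult_nth_vanishing(2)[OF D1] I0 top by (simp add: power2_eq_square)
  \<comment> \<open>\<open>G - H\<close> has order at least \<open>n\<close> and
    \<open>G + H\<close> has no constant term. So the top coefficient of \<open>G\<close> does not
    reach the quadratic part of any entry with \<open>d\<close> at most \<open>n\<close>.\<close>
  have G2: "G\<^sup>2 = H\<^sup>2 + (G - H) * (G + H)"
    by (simp add: algebra_simps power2_eq_square)
  have G2_le: "fps_nth (G\<^sup>2) k = fps_nth (H\<^sup>2) k" if "k \<le> n" for k
    unfolding G2 using that fps_mult_nth_vanishing[OF DG] G0 zero by (cases "k = n") auto
  have A_le: "fps_nth (F1 * F2) k = fps_nth (E1 * E2) k" if "k < Suc n" for k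
    using A_low[OF that] by simp
  have A_Suc: "of_real (fps_nth (F1 * F2) (Suc n)) = of_real (fps_nth (E1 * E2) (Suc n)) + u"
    unfolding A_n[symmetric] by simp
  note low_simps = A_le AI_low FI_low G2_le low
  show "skip_entry n w m F1 F2 G i j = skip_entry n w m E1 E2 H i j" if "Suc i - j < n - 1"
  proof -
    define d where "d = Suc i - j"
    have d: "d < n" "d \<le> n" "Suc d < Suc n" "d + 2 < Suc n"
      using that unfolding d_def by linarith+
    show ?thesis
      unfolding skip_entry_def Let_def I_def[symmetric] d_def[symmetric]
      by (simp only: A_le[OF d(4)] AI_low[OF d(3)] FI_low[OF d(1)] G2_le[OF d(2)] low(1,3)[OF d(1)])
  qed
  obtain N where N: "n = Suc (Suc N)"
    using n that[of "n - 2"] by simp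
  note hi = A_Suc[unfolded N] AI_n[unfolded N] FI_n[unfolded N]
  \<comment> \<open>Here and in the next entry \<open>d = n - 1\<close>, so \<open>F1 * F2\<close>
    enters at order \<open>n + 1\<close>. Its factor \<open>\<sigma> * (Suc i + j - n) / 2\<close>
    is \<open>n / 4\<close> here and \<open>(2 - n) / 4\<close> there.\<close>
  show "skip_entry n w m F1 F2 G (n - 2) 0 = skip_entry n w m E1 E2 H (n - 2) 0 + [:u * of_nat n / 4:]"
    unfolding skip_entry_def Let_def I_def[symmetric]
    by (simp add: low_simps N hi) (simp add: field_simps)
  show "skip_entry n w m F1 F2 G (n - 1) 1 = skip_entry n w m E1 E2 H (n - 1) 1 + [:u * (2 - of_nat n) / 4:]"
    unfolding skip_entry_def Let_def I_def[symmetric]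
    by (simp add: low_simps N hi) (simp add: field_simps)
  \<comment> \<open>Here \<open>d = n\<close>, and order \<open>n + 2\<close> of
    \<open>F1 * F2\<close> has the factor \<open>Suc i + j - n = 0\<close>. The term in
    \<open>u\<close> stems from \<open>F1 * F2 * I\<close> at order \<open>n + 1\<close>, with
    \<open>- \<sigma> = n / 2\<close>.\<close>
  show "skip_entry n w m F1 F2 G (n - 1) 0 = skip_entry n w m E1 E2 H (n - 1) 0
      + [:u * of_nat n / 2 - m\<^sup>2 * of_real (fps_nth F1 n), - 2 * w * of_real (fps_nth G n), - of_real (fps_nth F1 n):]"
    unfolding skip_entry_def Let_def I_def[symmetric]
    by (simp add: low_simps N hi top[unfolded N]) (simp add: field_simps)
qed

text \<open>Here \<open>d = 0\<close>: the linear and quadratic coefficients are built from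
  vanishing constant terms.\<close>

lemma skip_entry_superdiagonal:
  assumes "fps_nth F1 0 = 0" "fps_nth G 0 = 0"
  shows "degree (skip_entry n w m F1 F2 G i (Suc i)) = 0"
  using assms by (simp add: skip_entry_def Let_def power2_eq_square)

lemma skip_entry_degree: "degree (skip_entry n w m F1 F2 G i j) \<le> 2"
  by (simp add: skip_entry_def Let_def)

text \<open>Here \<open>d = 1\<close>, and the square of \<open>G\<close> starts at order 2 or
  later.\<close>

lemma skip_entry_diagonal:
  assumes "fps_nth G 0 = 0"
  shows "coeff (skip_entry n w m F1 F2 G i i) 2 = - of_real (fps_nth F1 1)"
  using assms by (simp add: skip_entry_def Let_def power2_eq_square fps_mult_nth_1 numeral_2_eq_2)

lemma skip_det_degree:
  assumes "fps_nth F1 0 = 0" "fps_nth G 0 = 0"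
  shows "degree (leading_det (skip_entry n w m F1 F2 G) n) \<le> 2 * n"
    and "coeff (leading_det (skip_entry n w m F1 F2 G) n) (2 * n) = (- of_real (fps_nth F1 1)) ^ n"
  using leading_det_hessenberg_degree[where e = "skip_entry n w m F1 F2 G" and d = 2,
      OF skip_entry_eq_0 skip_entry_superdiagonal[OF assms] skip_entry_degree
        skip_entry_diagonal[OF assms(2)]]
  by auto

text \<open>\<open>R0\<close> to \<open>R3\<close> are fixed before the series are given: they come
  from a reference matrix \<open>e\<close> built from the prescribed coefficients alone.\<close>

lemma skip_det_affine:
  fixes a1 a2 a3 :: "nat \<Rightarrow> real"
  assumes n: "n > 1"
  obtains R0 R1 R2 R3 where "coeff R3 0 = 0" "coeff R3 2 = 0"
    "\<And>F1 F2 G. fps_nth F1 0 = 0 \<Longrightarrow> fps_nth F2 0 = 0 \<Longrightarrow> fps_nth G 0 = 0 \<Longrightarrow>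
      (\<And>i. i \<in> {1..<n} \<Longrightarrow> fps_nth F1 i = a1 i \<and> fps_nth F2 i = a2 i \<and> fps_nth G i = a3 i) \<Longrightarrow>
      leading_det (skip_entry n w m F1 F2 G) n =
        R0 + smult (of_real (fps_nth F1 n)) R1 + smult (of_real (fps_nth F2 n)) R2
          + smult (of_real (fps_nth G n)) R3"
proof -
  define trunc where "trunc a = Abs_fps (\<lambda>i. if i \<in> {1..<n} then a i else 0)" for a :: "nat \<Rightarrow> real"
  define e where "e = skip_entry n w m (trunc a1) (trunc a2) (trunc a3)"
  define N where "N = n - 2"
  have N: "n = Suc (Suc N)" using n by (simp add: N_def)
  \<comment> \<open>\<open>X\<close>, \<open>Y\<close>, \<open>Z\<close> are the cofactors, in
    \<open>e\<close>, of the three corner entries that change; \<open>U\<close> gathers the weights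
    with which \<open>?u\<close> enters them.\<close>
  define X where "X = (\<Prod>t<N. - e t (Suc t)) * e (Suc N) (Suc N)"
  define Y where "Y = (\<Prod>t\<in>{1..<Suc N}. - e t (Suc t)) * leading_det e 1"
  define Z where "Z = (\<Prod>t<Suc N. - e t (Suc t))"
  define U where "U = smult (of_nat n / 4) X + smult ((2 - of_nat n) / 4) Y + smult (of_nat n / 2) Z"
  have "degree Z \<le> (\<Sum>t<Suc N. degree (- e t (Suc t)))"
    unfolding Z_def using degree_prod_sum_le[of "{..<Suc N}" "\<lambda>t. - e t (Suc t)"]
    by (simp only: finite_lessThan comp_def)
  also have "\<dots> = 0"
    by (simp add: e_def skip_entry_superdiagonal trunc_def)
  finally have "degree Z = 0" by simp
  then have Z1: "coeff Z 1 = 0"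
    by (intro coeff_eq_0) simp
  show thesis
  proof
    \<comment> \<open>Since \<open>Z\<close> is constant, the witness for \<open>R3\<close> has only
      a linear term.\<close>
    show "coeff ([:0, - 2 * w:] * Z) 0 = 0" "coeff ([:0, - 2 * w:] * Z) 2 = 0"
      using Z1 by (simp_all add: numeral_2_eq_2)
    fix F1 F2 G :: "real fps"
    assume F0: "fps_nth F1 0 = 0" "fps_nth F2 0 = 0" "fps_nth G 0 = 0"
      and Fi: "\<And>i. i \<in> {1..<n} \<Longrightarrow> fps_nth F1 i = a1 i \<and> fps_nth F2 i = a2 i \<and> fps_nth G i = a3 i"
    have low: "fps_nth F1 i = fps_nth (trunc a1) i" "fps_nth F2 i = fps_nth (trunc a2) i"
      "fps_nth G i = fps_nth (trunc a3) i" if "i < n" for i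
      using that F0 Fi[of i] by (auto simp: trunc_def Suc_le_eq)
    have zero: "fps_nth (trunc a) 0 = 0" and top: "fps_nth (trunc a) n = 0" for a
      by (auto simp: trunc_def)
    have one: "fps_nth (trunc a) 1 = a 1" for a
      using n by (simp add: trunc_def)
    let ?e = "skip_entry n w m F1 F2 G"
    let ?u = "of_real (a1 1 * fps_nth F2 n + fps_nth F1 n * a2 1) :: complex"
    note change = skip_entry_change[OF n low zero zero zero top top top, where w = w and m = m,
        folded e_def, unfolded one]
    have "leading_det ?e (Suc (Suc N)) = leading_det e (Suc (Suc N))
        + [:?u * of_nat n / 4:] * X + [:?u * (2 - of_nat n) / 4:] * Y
        + [:?u * of_nat n / 2 - m\<^sup>2 * of_real (fps_nth F1 n), - 2 * w * of_real (fps_nth G n),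
            - of_real (fps_nth F1 n):] * Z"
      unfolding X_def Y_def Z_def
    proof (rule leading_det_hessenberg_perturb)
      show "?e i j = e i j" if "i < j + N" for i j
        using change(1)[of i j] that N by simp
      show "?e N 0 = e N 0 + [:?u * of_nat n / 4:]"
        using change(2) N by simp
      show "?e (Suc N) 1 = e (Suc N) 1 + [:?u * (2 - of_nat n) / 4:]"
        using change(3) N by simp
      show "?e (Suc N) 0 = e (Suc N) 0 + [:?u * of_nat n / 2 - m\<^sup>2 * of_real (fps_nth F1 n),
          - 2 * w * of_real (fps_nth G n), - of_real (fps_nth F1 n):]"
        using change(4) N by simp
      \<comment> \<open>\<open>N = 0\<close> means \<open>n = 2\<close>, where the weight
        \<open>2 - n\<close> vanishes.\<close>
      show "[:?u * (2 - of_nat n) / 4:] = 0" if "N = 0"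
        using that N by simp
    qed (simp_all add: e_def skip_entry_eq_0)
    then have eq: "leading_det ?e n = leading_det e n
        + [:?u * of_nat n / 4:] * X + [:?u * (2 - of_nat n) / 4:] * Y
        + [:?u * of_nat n / 2 - m\<^sup>2 * of_real (fps_nth F1 n), - 2 * w * of_real (fps_nth G n),
            - of_real (fps_nth F1 n):] * Z"
      unfolding N[symmetric] .
    show "leading_det ?e n = leading_det e n
        + smult (of_real (fps_nth F1 n)) (smult (of_real (a2 1)) U - [:m\<^sup>2, 0, 1:] * Z)
        + smult (of_real (fps_nth F2 n)) (smult (of_real (a1 1)) U)
        + smult (of_real (fps_nth G n)) ([:0, - 2 * w:] * Z)"
      unfolding eq U_def
      by (simp add: poly_eq_poly_eq_iff[symmetric] fun_eq_iff field_simps power2_eq_square)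
  qed
qed

section \<open>The pole-skipping polynomial of a black hole\<close>

context
  fixes f1 f2 f3 :: "real \<Rightarrow> real" and T :: real and m :: complex
  assumes bh: "rotating_black_hole f1 f2 f3 T"
begin

lemma horizon_fps_black_hole:
  "fps_nth (horizon_fps f1) 0 = 0" "fps_nth (horizon_fps f2) 0 = 0"
  "fps_nth (horizon_fps f3 - fps_const (f3 1)) 0 = 0"
  "hcoeff f1 1 \<noteq> 0"
proof -
  have "hcoeff f 0 = f 1" if "analytic_at_horizon f" for f :: "real \<Rightarrow> real"
    using that expands_at_horizon_at_1 hcoeff_real unfolding analytic_at_horizon_def by blast
  then show "fps_nth (horizon_fps f1) 0 = 0" "fps_nth (horizon_fps f2) 0 = 0"
      "fps_nth (horizon_fps f3 - fps_const (f3 1)) 0 = 0"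
    using bh by (auto simp: rotating_black_hole_def horizon_fps_def)
  have "T > 0" "hcoeff f1 1 * hcoeff f2 1 = (4 * pi * T)\<^sup>2"
    using bh by (auto simp: rotating_black_hole_def)
  then show "hcoeff f1 1 \<noteq> 0"
    by auto
qed

text \<open>A complex polynomial is determined by its values, so the definite description denotes
  the determinant of the entry polynomials.\<close>

lemma skip_poly_eq:
  "skip_poly f1 f2 f3 T m n = leading_det (skip_entry n (w_skip T n) m (horizon_fps f1)
     (horizon_fps f2) (horizon_fps f3 - fps_const (f3 1))) n" (is "_ = ?P")
  and poly_skip_poly: "poly (skip_poly f1 f2 f3 T m n) k = det (M_mat f1 f2 f3 T m n k)"
proof -
  have P: "poly ?P k = det (M_mat f1 f2 f3 T m n k)" for k
    by (subst leading_det_hessenberg_poly) (simp_all add: skip_entry_eq_0 leading_det_def M_mat_def M_entry_eq[OF bh])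
  show "skip_poly f1 f2 f3 T m n = ?P"
    unfolding skip_poly_def
  proof (rule the_equality)
    show "Q = ?P" if "\<forall>k. poly Q k = det (M_mat f1 f2 f3 T m n k)" for Q
      using that P by (metis poly_eq_poly_eq_iff ext)
  qed (use P in blast)
  then show "poly (skip_poly f1 f2 f3 T m n) k = det (M_mat f1 f2 f3 T m n k)"
    using P by simp
qed

lemma coeff_skip_poly_top:
  "coeff (skip_poly f1 f2 f3 T m n) (2 * n) = (- of_real (hcoeff f1 1)) ^ n"
  unfolding skip_poly_eq using skip_det_degree(2)[OF horizon_fps_black_hole(1,3)]
  by (simp add: horizon_fps_def)

lemma degree_skip_poly: "degree (skip_poly f1 f2 f3 T m n) = 2 * n"
proof (rule antisym)
  show "degree (skip_poly f1 f2 f3 T m n) \<le> 2 * n"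
    unfolding skip_poly_eq by (rule skip_det_degree(1)[OF horizon_fps_black_hole(1,3)])
  show "2 * n \<le> degree (skip_poly f1 f2 f3 T m n)"
    using horizon_fps_black_hole(4) by (intro le_degree) (simp add: coeff_skip_poly_top)
qed

text \<open>The sign in \<open>v_coeff\<close> absorbs exactly the \<open>(-1) ^ j\<close> of
  Vieta's formula.\<close>

lemma skip_poly_vieta:
  assumes "enumerates_roots (skip_poly f1 f2 f3 T m n) (2 * n) \<kappa>" "j \<le> 2 * n"
  shows "elem_sym (2 * n) \<kappa> j = v_coeff f1 f2 f3 T m n (2 * n - j) / v_coeff f1 f2 f3 T m n (2 * n)"
proof -
  let ?P = "skip_poly f1 f2 f3 T m n"
  have c: "coeff ?P (2 * n - j) = coeff ?P (2 * n) * ((-1) ^ j * elem_sym (2 * n) \<kappa> j)"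
    using coeff_eq_elem_sym_roots[OF assms(1) degree_skip_poly assms(2)] degree_skip_poly by simp
  have nz: "coeff ?P (2 * n) \<noteq> 0"
    using horizon_fps_black_hole(4) by (simp add: coeff_skip_poly_top)
  have e: "int n - int (2 * n - j) = (int n - int (2 * n)) + int j"
    using assms(2) by simp
  have "(-1 :: complex) powi (int n - int (2 * n - j)) = (-1) powi (int n - int (2 * n)) * (-1) ^ j"
    unfolding e by (subst power_int_add) simp_all
  then show ?thesis
    unfolding v_coeff_def c using nz by (simp add: field_simps flip: power_mult_distrib)
qed

end

theorem theorem1:
  fixes n :: nat and T :: real and m :: complex and a1 a2 a3 :: "nat \<Rightarrow> real"
  assumes "n > 1"
  shows
    "(\<forall>(f1, f2, f3) \<in> black_holes_with n T a1 a2 a3.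
        (\<forall>k. poly (skip_poly f1 f2 f3 T m n) k = det (M_mat f1 f2 f3 T m n k)) \<and>
        degree (skip_poly f1 f2 f3 T m n) = 2 * n \<and>
        (\<forall>\<kappa>. enumerates_roots (skip_poly f1 f2 f3 T m n) (2 * n) \<kappa> \<longrightarrow>
           (\<forall>j\<in>{1..2 * n}. elem_sym (2 * n) \<kappa> j =
              v_coeff f1 f2 f3 T m n (2 * n - j) / v_coeff f1 f2 f3 T m n (2 * n))))
     \<and> (\<exists>c0 c1 c2 :: complex. \<forall>(f1, f2, f3) \<in> black_holes_with n T a1 a2 a3.
          v_coeff f1 f2 f3 T m n 0 / v_coeff f1 f2 f3 T m n (2 * n) =
            c0 + c1 * of_real (hcoeff f1 n) + c2 * of_real (hcoeff f2 n))
     \<and> (\<exists>c0 c1 c2 c3 :: complex. \<forall>(f1, f2, f3) \<in> black_holes_with n T a1 a2 a3.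
          v_coeff f1 f2 f3 T m n 1 / v_coeff f1 f2 f3 T m n (2 * n) =
            c0 + c1 * of_real (hcoeff f1 n) + c2 * of_real (hcoeff f2 n)
               + c3 * of_real (hcoeff f3 n))
     \<and> (\<exists>c0 c1 c2 :: complex. \<forall>(f1, f2, f3) \<in> black_holes_with n T a1 a2 a3.
          v_coeff f1 f2 f3 T m n 2 / v_coeff f1 f2 f3 T m n (2 * n) =
            c0 + c1 * of_real (hcoeff f1 n) + c2 * of_real (hcoeff f2 n))"
proof -
  obtain R0 R1 R2 R3 where R3: "coeff R3 0 = 0" "coeff R3 2 = 0" and
    R: "\<And>F1 F2 G. fps_nth F1 0 = 0 \<Longrightarrow> fps_nth F2 0 = 0 \<Longrightarrow> fps_nth G 0 = 0 \<Longrightarrow>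
      (\<And>i. i \<in> {1..<n} \<Longrightarrow> fps_nth F1 i = a1 i \<and> fps_nth F2 i = a2 i \<and> fps_nth G i = a3 i) \<Longrightarrow>
      leading_det (skip_entry n (w_skip T n) m F1 F2 G) n =
        R0 + smult (of_real (fps_nth F1 n)) R1 + smult (of_real (fps_nth F2 n)) R2
          + smult (of_real (fps_nth G n)) R3"
    by (rule skip_det_affine[OF assms, where w = "w_skip T n" and m = m and ?a1.0 = a1 and ?a2.0 = a2 and ?a3.0 = a3])
      blast
  \<comment> \<open>The denominator is that of the Vieta quotient. As \<open>n > 1\<close>, the
    first coefficient of \<open>f1\<close> is the prescribed \<open>a1 1\<close>, so
    \<open>s\<close> is the same for all admissible black holes.\<close>
  define s :: "nat \<Rightarrow> complex" where "s j = (-1) powi (int n - int j) / ((-1) powi (int n - int (2 * n)) * (- of_real (a1 1)) ^ n)"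
    for j :: nat
  \<comment> \<open>The claims are the cases \<open>j = 0\<close>, \<open>1\<close>,
    \<open>2\<close>; the zero coefficients of \<open>R3\<close> remove \<open>f3\<close> from the
    first and last.\<close>
  have v: "v_coeff f1 f2 f3 T m n j / v_coeff f1 f2 f3 T m n (2 * n) =
      s j * coeff R0 j + s j * coeff R1 j * of_real (hcoeff f1 n) + s j * coeff R2 j * of_real (hcoeff f2 n)
        + s j * coeff R3 j * of_real (hcoeff f3 n)"
    if "(f1, f2, f3) \<in> black_holes_with n T a1 a2 a3" for f1 f2 f3 j
  proof -
    have bh: "rotating_black_hole f1 f2 f3 T"
      and a: "\<And>i. i \<in> {1..<n} \<Longrightarrow> hcoeff f1 i = a1 i \<and> hcoeff f2 i = a2 i \<and> hcoeff f3 i = a3 i"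
      using that by (auto simp: black_holes_with_def)
    \<comment> \<open>Subtracting the constant \<open>f3 1\<close> alters order 0 only, so order
      \<open>n\<close> is still that of \<open>f3\<close>.\<close>
    have "skip_poly f1 f2 f3 T m n = R0 + smult (of_real (hcoeff f1 n)) R1
        + smult (of_real (hcoeff f2 n)) R2 + smult (of_real (hcoeff f3 n)) R3"
      unfolding skip_poly_eq[OF bh]
      by (subst R[OF horizon_fps_black_hole(1-3)[OF bh]]) (use a assms in \<open>auto simp: horizon_fps_def\<close>)
    moreover have "hcoeff f1 1 = a1 1"
      using a assms by simp
    ultimately show ?thesis
      unfolding v_coeff_def coeff_skip_poly_top[OF bh] s_def
      by (simp add: add_divide_distrib distrib_left mult_ac)
  qed
  show ?thesis
  proof (intro conjI)
    show "\<forall>(f1, f2, f3) \<in> black_holes_with n T a1 a2 a3.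
        (\<forall>k. poly (skip_poly f1 f2 f3 T m n) k = det (M_mat f1 f2 f3 T m n k)) \<and>
        degree (skip_poly f1 f2 f3 T m n) = 2 * n \<and>
        (\<forall>\<kappa>. enumerates_roots (skip_poly f1 f2 f3 T m n) (2 * n) \<kappa> \<longrightarrow>
           (\<forall>j\<in>{1..2 * n}. elem_sym (2 * n) \<kappa> j =
              v_coeff f1 f2 f3 T m n (2 * n - j) / v_coeff f1 f2 f3 T m n (2 * n)))"
      unfolding black_holes_with_def
      by (auto simp: poly_skip_poly degree_skip_poly skip_poly_vieta)
    show "\<exists>c0 c1 c2 :: complex. \<forall>(f1, f2, f3) \<in> black_holes_with n T a1 a2 a3.
          v_coeff f1 f2 f3 T m n 0 / v_coeff f1 f2 f3 T m n (2 * n) =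
            c0 + c1 * of_real (hcoeff f1 n) + c2 * of_real (hcoeff f2 n)"
      by (intro exI[of _ "s 0 * coeff R0 0"] exI[of _ "s 0 * coeff R1 0"] exI[of _ "s 0 * coeff R2 0"])
         (auto simp: v R3)
    show "\<exists>c0 c1 c2 c3 :: complex. \<forall>(f1, f2, f3) \<in> black_holes_with n T a1 a2 a3.
          v_coeff f1 f2 f3 T m n 1 / v_coeff f1 f2 f3 T m n (2 * n) =
            c0 + c1 * of_real (hcoeff f1 n) + c2 * of_real (hcoeff f2 n)
               + c3 * of_real (hcoeff f3 n)"
      using v[of _ _ _ 1] by blast
    show "\<exists>c0 c1 c2 :: complex. \<forall>(f1, f2, f3) \<in> black_holes_with n T a1 a2 a3.
          v_coeff f1 f2 f3 T m n 2 / v_coeff f1 f2 f3 T m n (2 * n) =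
            c0 + c1 * of_real (hcoeff f1 n) + c2 * of_real (hcoeff f2 n)"
      by (intro exI[of _ "s 2 * coeff R0 2"] exI[of _ "s 2 * coeff R1 2"] exI[of _ "s 2 * coeff R2 2"])
         (auto simp: v R3)
  qed
qed

end
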